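(* Let $\{T_w\}_{w\in\Omega}$ be a continuous operator frame for $End_{\mathcal A}^{*}(\mathcal H)$ with bounds $A$ and $B$. If $\{R_w\}_{w\in\Omega}\subset End_{\mathcal A}^{*}(\mathcal H)$ is a continuous Bessel operator family with bound $M<A$, then both $\{T_w+R_w\}_{w\in\Omega}$ and $\{T_w-R_w\}_{w\in\Omega}$ are continuous operator frames for $End_{\mathcal A}^{*}(\mathcal H)$.
   Context: $\mathcal A$ is a unital $C^*$-algebra, $\mathcal H$ is a (left) Hilbert $\mathcal A$-module with $\mathcal A$-valued inner product $\langle\cdot,\cdot\rangle_{\mathcal A}$ ($\mathcal A$-linear in the first variable) and norm $\|x\|=\|\langle x,x\rangle_{\mathcal A}\|^{1/2}$, and $End_{\mathcal A}^{*}(\mathcal H)$ is the set of adjointable operators $\mathcal H\to\mathcal H$. $(\Omega,\mu)$ is a measure space; integrals of Banach-space-valued functions are Bochner integrals. Inequalities between elements of $\mathcal A$ refer to the order given by the positive cone $\mathcal A^+$. A family $\{\Lambda_w\}_{w\in\Omega}\subset End_{\mathcal A}^{*}(\mathcal H)$ is a continuous operator frame for $End_{\mathcal A}^{*}(\mathcal H)$ with bounds $A,B>0$ if (a) for every $x\in\mathcal H$ the map $w\mapsto\Lambda_w x$ is measurable, and (b) for every $x\in\mathcal H$, $A\langle x,x\rangle_{\mathcal A}\le\int_\Omega\langle\Lambda_w x,\Lambda_w x\rangle_{\mathcal A}\,d\mu(w)\le B\langle x,x\rangle_{\mathcal A}$. It is called a continuous operator frame if such $A,B>0$ exist. If (a)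 holds and only the right-hand inequality in (b) is required, the family is called a continuous Bessel operator family with bound $B$. *)

theory Defs
  imports "HOL-Analysis.Analysis"
begin

section \<open>Complex Banach spaces and unital C*-algebras\<close>

class complex_vector = real_vector +
  fixes scaleC :: "complex \<Rightarrow> 'a \<Rightarrow> 'a"  (infixr \<open>*\<^sub>C\<close> 75)
  assumes scaleC_add_right: "c *\<^sub>C (x + y) = c *\<^sub>C x + c *\<^sub>C y"
    and scaleC_add_left: "(c + d) *\<^sub>C x = c *\<^sub>C x + d *\<^sub>C x"
    and scaleC_scaleC: "c *\<^sub>C (d *\<^sub>C x) = (c * d) *\<^sub>C x"
    and scaleC_one: "1 *\<^sub>C x = x"
    and scaleR_scaleC: "r *\<^sub>R x = complex_of_real r *\<^sub>C x"

class complex_normed_vector = complex_vector + real_normed_vector +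
  assumes norm_scaleC: "norm (c *\<^sub>C x) = cmod c * norm x"

class cbanach = complex_normed_vector + banach

text \<open>The class \<open>real_normed_algebra_1\<close> contributes the ring structure, the submultiplicative
  norm and \<open>norm 1 = 1\<close>; in particular the zero algebra is excluded.\<close>

class unital_cstar_algebra = cbanach + real_normed_algebra_1 +
  fixes star :: "'a \<Rightarrow> 'a"
  assumes mult_scaleC_left: "(c *\<^sub>C a) * b = c *\<^sub>C (a * b)"
    and mult_scaleC_right: "a * (c *\<^sub>C b) = c *\<^sub>C (a * b)"
    and star_star: "star (star a) = a"
    and star_add: "star (a + b) = star a + star b"
    and star_scaleC: "star (c *\<^sub>C a) = cnj c *\<^sub>C star a"
    and star_mult: "star (a * b) = star b * star a"
    and cstar_identity: "norm (star a * a) = (norm a)\<^sup>2"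

definition spectrum :: "'a::unital_cstar_algebra \<Rightarrow> complex set" where
  "spectrum a = {c. \<not> (\<exists>b. b * (a - c *\<^sub>C 1) = 1 \<and> (a - c *\<^sub>C 1) * b = 1)}"

definition positive_cone :: "'a::unital_cstar_algebra set" where
  "positive_cone = {a. star a = a \<and> spectrum a \<subseteq> \<real>\<^sub>\<ge>\<^sub>0}"

definition cstar_le :: "'a::unital_cstar_algebra \<Rightarrow> 'a \<Rightarrow> bool"  (infix \<open>\<preceq>\<close> 50) where
  "a \<preceq> b \<longleftrightarrow> b - a \<in> positive_cone"


section \<open>Hilbert modules and adjointable operators\<close>

text \<open>The norm of the module is the norm of the type class; the last assumption identifies it with
  the norm induced by the inner product, so \<open>cbanach\<close> expresses completeness of the module.\<close>

locale hilbert_module =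
  fixes act :: "'a::unital_cstar_algebra \<Rightarrow> 'h::cbanach \<Rightarrow> 'h"  (infixr \<open>\<cdot>\<close> 75)
    and ip :: "'h \<Rightarrow> 'h \<Rightarrow> 'a"
  assumes act_add_right: "a \<cdot> (x + y) = a \<cdot> x + a \<cdot> y"
    and act_add_left: "(a + b) \<cdot> x = a \<cdot> x + b \<cdot> x"
    and act_mult: "(a * b) \<cdot> x = a \<cdot> (b \<cdot> x)"
    and act_one: "1 \<cdot> x = x"
    and act_scaleC_left: "(c *\<^sub>C a) \<cdot> x = c *\<^sub>C (a \<cdot> x)"
    and act_scaleC_right: "a \<cdot> (c *\<^sub>C x) = c *\<^sub>C (a \<cdot> x)"
    and ip_add_left: "ip (x + y) z = ip x z + ip y z"
    and ip_act_left: "ip (a \<cdot> x) y = a * ip x y"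
    and ip_star: "ip x y = star (ip y x)"
    and ip_pos: "ip x x \<in> positive_cone"
    and ip_definite: "ip x x = 0 \<Longrightarrow> x = 0"
    and norm_ip: "norm x = sqrt (norm (ip x x))"

definition adjointable :: "('h::cbanach \<Rightarrow> 'h \<Rightarrow> 'a::unital_cstar_algebra) \<Rightarrow> ('h \<Rightarrow> 'h) set" where
  "adjointable ip = {T. \<exists>S. \<forall>x y. ip (T x) y = ip x (S y)}"


section \<open>The Bochner integral in arbitrary Banach spaces\<close>

text \<open>The library's \<^const>\<open>has_bochner_integral\<close> is restricted to second countable (that is, separable)
  value spaces, which would exclude most C*-algebras. Below, Borel measurability is
  replaced by strong measurability; the rest of the definition is the library's. Borel
  measurability would not do: without separability the sum of two Borel measurable functions
  need not be Borel measurable.\<close>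

definition strongly_measurable :: "'w measure \<Rightarrow> ('w \<Rightarrow> 'b::real_normed_vector) \<Rightarrow> bool" where
  "strongly_measurable M f \<longleftrightarrow>
    (\<exists>s. (\<forall>i. simple_function M (s i)) \<and> (AE w in M. (\<lambda>i. s i w) \<longlonglongrightarrow> f w))"

definition has_Bochner_integral ::
    "'w measure \<Rightarrow> ('w \<Rightarrow> 'b::banach) \<Rightarrow> 'b \<Rightarrow> bool" where
  "has_Bochner_integral M f I \<longleftrightarrow>
    strongly_measurable M f \<and>
    (\<exists>s. (\<forall>i. Bochner_Integration.simple_bochner_integrable M (s i)) \<and>
         (\<lambda>i. \<integral>\<^sup>+ w. ennreal (norm (f w - s i w)) \<partial>M) \<longlonglongrightarrow> 0 \<and>
         (\<lambda>i. Bochner_Integration.simple_bochner_integral M (s i)) \<longlonglongrightarrow> I)"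

lemma has_Bochner_integral_if_has_bochner_integral:
  fixes f :: "'w \<Rightarrow> 'b::{banach, second_countable_topology}"
  assumes "has_bochner_integral M f I"
  shows "has_Bochner_integral M f I"
  using assms
proof cases
  case (1 s)
  obtain t where "\<And>i. simple_function M (t i)"
    and "\<And>w. w \<in> space M \<Longrightarrow> (\<lambda>i. t i w) \<longlonglongrightarrow> f w"
    using borel_measurable_implies_sequence_metric[OF 1(1), of 0] by metis
  then have "strongly_measurable M f"
    unfolding strongly_measurable_def by (intro exI[of _ t]) auto
  with 1 show ?thesis
    unfolding has_Bochner_integral_def by blast
qed


section \<open>Continuous operator frames\<close>

text \<open>The existence of the Bochner integral of \<open>ip (\<Lambda> w x) (\<Lambda> w x)\<close> is part of the inequalities
  in which it occurs.\<close>

definition continuous_operator_frame_with_bounds ::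
    "'w measure \<Rightarrow> ('h::cbanach \<Rightarrow> 'h \<Rightarrow> 'a::unital_cstar_algebra) \<Rightarrow> ('w \<Rightarrow> 'h \<Rightarrow> 'h)
      \<Rightarrow> real \<Rightarrow> real \<Rightarrow> bool" where
  "continuous_operator_frame_with_bounds \<mu> ip \<Lambda> A B \<longleftrightarrow>
    0 < A \<and> 0 < B \<and>
    (\<forall>w\<in>space \<mu>. \<Lambda> w \<in> adjointable ip) \<and>
    (\<forall>x. strongly_measurable \<mu> (\<lambda>w. \<Lambda> w x)) \<and>
    (\<forall>x. \<exists>I. has_Bochner_integral \<mu> (\<lambda>w. ip (\<Lambda> w x) (\<Lambda> w x)) I \<and>
             A *\<^sub>R ip x x \<preceq> I \<and> I \<preceq> B *\<^sub>R ip x x)"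

definition continuous_operator_frame ::
    "'w measure \<Rightarrow> ('h::cbanach \<Rightarrow> 'h \<Rightarrow> 'a::unital_cstar_algebra) \<Rightarrow> ('w \<Rightarrow> 'h \<Rightarrow> 'h) \<Rightarrow> bool" where
  "continuous_operator_frame \<mu> ip \<Lambda> \<longleftrightarrow>
    (\<exists>A B. continuous_operator_frame_with_bounds \<mu> ip \<Lambda> A B)"

definition continuous_bessel_family ::
    "'w measure \<Rightarrow> ('h::cbanach \<Rightarrow> 'h \<Rightarrow> 'a::unital_cstar_algebra) \<Rightarrow> ('w \<Rightarrow> 'h \<Rightarrow> 'h)
      \<Rightarrow> real \<Rightarrow> bool" where
  "continuous_bessel_family \<mu> ip \<Lambda> B \<longleftrightarrow>
    0 < B \<and>
    (\<forall>w\<in>space \<mu>. \<Lambda> w \<in> adjointable ip) \<and>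
    (\<forall>x. strongly_measurable \<mu> (\<lambda>w. \<Lambda> w x)) \<and>
    (\<forall>x. \<exists>I. has_Bochner_integral \<mu> (\<lambda>w. ip (\<Lambda> w x) (\<Lambda> w x)) I \<and> I \<preceq> B *\<^sub>R ip x x)"

end

theory Submission
  imports Defs
begin

text \<open>
  For fixed \<open>x\<close>, the lower frame bound has to control the mixed terms in
  \<open>ip (T w x + R w x) (T w x + R w x)\<close> in the order of the algebra. For positive reals with
  \<open>a b = 1\<close>, positivity of \<open>ip (a T w x + b R w x) (a T w x + b R w x)\<close> gives
  \<open>ip (T w x + R w x) (T w x + R w x) \<succeq> (1 - a\<^sup>2) ip (T w x) (T w x) + (1 - b\<^sup>2) ip (R w x) (R w x)\<close>.
  After integration, the lower bound \<open>A\<close> for \<open>T\<close> and the upper bound \<open>M\<close> for \<open>R\<close> yield, for the best choice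
  of \<open>a\<close>, the frame bound \<open>(sqrt A - sqrt M)\<^sup>2\<close>, positive as \<open>M < A\<close>. The parallelogram law gives the
  upper bound \<open>2 (B + M)\<close>. The difference \<open>T - R\<close> is covered by replacing \<open>R\<close> with \<open>- R\<close>, which is a
  Bessel family with the same bound.

  This argument rests on three facts.

  The positive cone, defined by the spectrum, is a closed convex cone
  (\<open>convex_cone_positive_cone\<close>, \<open>closed_positive_cone\<close>). This is read off from a description of
  positivity by the norm, \<open>\<parallel>\<parallel>a\<parallel> - a\<parallel> \<le> \<parallel>a\<parallel>\<close> for self-adjoint \<open>a\<close>, which in turn
  requires that \<open>\<parallel>a\<parallel>\<close> or \<open>- \<parallel>a\<parallel>\<close> is a spectral value (\<open>norm_in_spectrum\<close>). The latter is proved by an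
  elementary averaging argument on the resolvent.

  The Bochner integral of a function with values in a closed convex cone lies in that cone
  (\<open>has_Bochner_integral_in_convex_cone\<close>), so pointwise inequalities can be integrated.

  The integral of \<open>ip (T w x + R w x) (T w x + R w x)\<close> exists
  (\<open>ex_has_Bochner_integral_ip_add\<close>). Strong measurability follows from continuity of the inner
  product, integrability of the norm from \<open>\<parallel>ip z z\<parallel> = \<parallel>z\<parallel>\<^sup>2\<close>, and these suffice by Bochner's criterion.
\<close>


section \<open>Invertibility and the spectrum in a unital C*-algebra\<close>

definition inverse_of :: "'a::ring_1 \<Rightarrow> 'a \<Rightarrow> bool" where
  "inverse_of a b \<longleftrightarrow> b * a = 1 \<and> a * b = 1"

lemma scaleC_zero_left [simp]: "0 *\<^sub>C (x::'a::complex_vector) = 0"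
  using scaleC_add_left[of 0 0 x] by simp

lemma scaleC_minus_left [simp]: "(- c) *\<^sub>C (x::'a::complex_vector) = - (c *\<^sub>C x)"
  using scaleC_add_left[of c "- c" x] by (simp add: eq_neg_iff_add_eq_0 add.commute)

lemma scaleC_minus_right [simp]: "c *\<^sub>C (- x) = - (c *\<^sub>C (x::'a::complex_vector))"
proof -
  have "c *\<^sub>C (0::'a) = 0"
    using scaleC_add_right[of c "0::'a" 0] by simp
  then show ?thesis
    using scaleC_add_right[of c x "- x"] by (simp add: eq_neg_iff_add_eq_0 add.commute)
qed

lemma scaleC_diff_left: "(c - d) *\<^sub>C (x::'a::complex_vector) = c *\<^sub>C x - d *\<^sub>C x"
  using scaleC_add_left[of c "- d" x] by simp

lemma scaleC_diff_right: "c *\<^sub>C (x - y) = c *\<^sub>C x - c *\<^sub>C (y::'a::complex_vector)"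
  using scaleC_add_right[of c x "- y"] by simp

lemma star_zero [simp]: "star (0::'a::unital_cstar_algebra) = 0"
  using star_add[of "0::'a" 0] by simp

lemma star_minus [simp]: "star (- a) = - star (a::'a::unital_cstar_algebra)"
  using star_add[of a "- a"] by (simp add: eq_neg_iff_add_eq_0 add.commute)

lemma star_diff: "star (a - b) = star a - star (b::'a::unital_cstar_algebra)"
  using star_add[of a "- b"] by simp

lemma star_one [simp]: "star (1::'a::unital_cstar_algebra) = 1"
  by (metis mult_1 mult_1_right star_mult star_star)

lemma star_scaleR [simp]: "star (r *\<^sub>R a) = r *\<^sub>R star (a::'a::unital_cstar_algebra)"
  by (simp add: scaleR_scaleC star_scaleC)

lemma norm_star [simp]: "norm (star a) = norm (a::'a::unital_cstar_algebra)"
proof -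
  have *: "norm b \<le> norm (star b)" for b :: 'a
  proof (cases "b = 0")
    case False
    have "norm b * norm b \<le> norm (star b) * norm b"
      using norm_mult_ineq[of "star b" b] by (simp add: cstar_identity power2_eq_square)
    then show ?thesis using False by simp
  qed simp
  show ?thesis using *[of a] *[of "star a"] by (simp add: star_star)
qed

lemma not_in_spectrum_iff:
  "c \<notin> spectrum a \<longleftrightarrow> (\<exists>b. inverse_of (a - c *\<^sub>C 1) b)"
  by (simp add: spectrum_def inverse_of_def)

lemma inverse_of_scaleC:
  fixes a :: "'a::unital_cstar_algebra"
  assumes "inverse_of a b" "c \<noteq> 0"
  shows "inverse_of (c *\<^sub>C a) (inverse c *\<^sub>C b)"
  using assms
  by (simp add: inverse_of_def mult_scaleC_left mult_scaleC_right scaleC_scaleC scaleC_one)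

lemma inverse_of_one_minus:
  fixes x :: "'a::{real_normed_algebra_1, banach}"
  assumes "norm x < 1"
  shows "inverse_of (1 - x) (\<Sum>n. x ^ n)"
proof -
  have "summable (\<lambda>n. norm (x ^ n))"
    by (rule summable_comparison_test[of _ "\<lambda>n. norm x ^ n"])
       (use assms in \<open>auto intro!: summable_geometric norm_power_ineq\<close>)
  then have S: "summable (\<lambda>n. x ^ n)" by (rule summable_norm_cancel)
  let ?S = "\<Sum>n. x ^ n"
  have "?S = 1 + (\<Sum>n. x ^ Suc n)"
    using suminf_split_head[OF S] by simp
  moreover have "(\<Sum>n. x ^ Suc n) = x * ?S"
    using suminf_mult[OF S, of x] by simp
  moreover have "(\<Sum>n. x ^ Suc n) = ?S * x"
    using suminf_mult2[OF S, of x] by (simp add: power_commutes)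
  ultimately show ?thesis
    by (simp add: inverse_of_def algebra_simps)
qed

lemma cmod_spectrum_le_norm:
  fixes a :: "'a::unital_cstar_algebra"
  assumes "c \<in> spectrum a"
  shows "cmod c \<le> norm a"
proof (rule ccontr)
  assume "\<not> cmod c \<le> norm a"
  then have lt: "norm a < cmod c" and c: "c \<noteq> 0"
    using norm_ge_zero[of a] by (auto simp: not_le simp del: norm_ge_zero)
  have "norm (inverse c *\<^sub>C a) < 1"
    using lt c by (simp add: norm_scaleC norm_inverse divide_inverse[symmetric] mult.commute)
  then obtain b where "inverse_of (1 - inverse c *\<^sub>C a) b"
    using inverse_of_one_minus by blast
  from inverse_of_scaleC[OF this, of "- c"] c
  have "inverse_of (a - c *\<^sub>C 1) (inverse (- c) *\<^sub>C b)"
    by (simp add: scaleC_diff_right scaleC_scaleC scaleC_one)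
  with assms show False
    using not_in_spectrum_iff by blast
qed

lemma spectrum_shift: "c + d \<in> spectrum (a + d *\<^sub>C 1) \<longleftrightarrow> c \<in> spectrum a"
  by (simp add: spectrum_def scaleC_add_left)

lemma spectrum_reflect:
  fixes a :: "'a::unital_cstar_algebra"
  shows "d - c \<in> spectrum (d *\<^sub>C 1 - a) \<longleftrightarrow> c \<in> spectrum a"
proof -
  have eq: "d *\<^sub>C 1 - a - (d - c) *\<^sub>C 1 = (- 1) *\<^sub>C (a - c *\<^sub>C 1)"
    by (simp add: scaleC_diff_left scaleC_one)
  have "(\<exists>b. inverse_of ((- 1) *\<^sub>C (a - c *\<^sub>C 1)) b) \<longleftrightarrow> (\<exists>b. inverse_of (a - c *\<^sub>C 1) b)"
    using inverse_of_scaleC[of "a - c *\<^sub>C 1" _ "- 1"]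
      inverse_of_scaleC[of "(- 1) *\<^sub>C (a - c *\<^sub>C 1)" _ "- 1"]
    by (auto simp: scaleC_one)
  then show ?thesis
    using not_in_spectrum_iff[of c a] not_in_spectrum_iff[of "d - c" "d *\<^sub>C 1 - a"]
    unfolding eq by blast
qed

text \<open>Adding \<open>\<i> t\<close> to \<open>a\<close> moves the spectrum by the same amount, while the C*-identity
  lets the norm grow no faster than \<open>sqrt (\<parallel>a\<parallel>\<^sup>2 + t\<^sup>2)\<close>. A nonzero imaginary part of a spectral value
  would outrun this for large \<open>t\<close>.\<close>

lemma spectrum_selfadjoint_real:
  fixes a :: "'a::unital_cstar_algebra"
  assumes sa: "star a = a" and c: "c \<in> spectrum a"
  shows "Im c = 0"
proof (rule ccontr)
  assume im: "Im c \<noteq> 0"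
  have key: "2 * t * Im c \<le> (norm a)\<^sup>2" for t :: real
  proof -
    let ?d = "Complex 0 t"
    have "c + ?d \<in> spectrum (a + ?d *\<^sub>C 1)" using c spectrum_shift by blast
    then have "cmod (c + ?d) \<le> norm (a + ?d *\<^sub>C 1)" by (rule cmod_spectrum_le_norm)
    then have "(cmod (c + ?d))\<^sup>2 \<le> (norm (a + ?d *\<^sub>C 1))\<^sup>2" by (rule power_mono) simp
    also have "\<dots> = norm (star (a + ?d *\<^sub>C 1) * (a + ?d *\<^sub>C 1))" by (simp add: cstar_identity)
    also have "star (a + ?d *\<^sub>C 1) * (a + ?d *\<^sub>C 1) = a * a + complex_of_real (t\<^sup>2) *\<^sub>C 1"
    proof -
      have "cnj ?d = - ?d" "?d * ?d = - complex_of_real (t\<^sup>2)"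
        by (simp_all add: complex_eq_iff power2_eq_square)
      then show ?thesis
        by (simp add: star_add star_scaleC sa distrib_left distrib_right left_diff_distrib
            right_diff_distrib scaleC_diff_right mult_scaleC_left mult_scaleC_right scaleC_scaleC)
    qed
    also have "norm (a * a + complex_of_real (t\<^sup>2) *\<^sub>C 1) \<le> (norm a)\<^sup>2 + t\<^sup>2"
      by (rule order_trans[OF norm_triangle_ineq])
         (use norm_mult_ineq[of a a] in \<open>simp add: norm_scaleC power2_eq_square norm_mult\<close>)
    finally have "(Re c)\<^sup>2 + (Im c + t)\<^sup>2 \<le> (norm a)\<^sup>2 + t\<^sup>2"
      by (simp add: cmod_power2)
    then have "(Re c)\<^sup>2 + (Im c)\<^sup>2 + 2 * t * Im c \<le> (norm a)\<^sup>2"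
      by (simp add: power2_sum algebra_simps)
    then show ?thesis
      using zero_le_power2[of "Re c"] zero_le_power2[of "Im c"] by linarith
  qed
  from key[of "((norm a)\<^sup>2 + 1) / (2 * Im c)"] im show False by simp
qed


section \<open>The norm of a self-adjoint element lies in its spectrum up to sign\<close>

text \<open>An instance of averaging a resolvent over roots of unity:
  \<open>1 / (1 - c\<^sup>2)\<close> is the mean of \<open>1 / (1 - c)\<close> and \<open>1 / (1 + c)\<close>. It lets properties of the
  resolvent of an element pass to its square.\<close>

lemma inverse_of_average:
  fixes c :: "'a::real_algebra_1"
  assumes u: "inverse_of (1 - c) u" and v: "inverse_of (1 + c) v"
  shows "inverse_of (1 - c * c) ((1/2) *\<^sub>R (u + v))"
proof -
  have f: "1 - c * c = (1 + c) * (1 - c)" "1 - c * c = (1 - c) * (1 + c)"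
    by (simp_all add: algebra_simps)
  have "(1 - c * c) * u = 1 + c" "(1 - c * c) * v = 1 - c"
    using u v unfolding inverse_of_def by (metis f mult.assoc mult_1_right)+
  moreover have "u * (1 - c * c) = 1 + c" "v * (1 - c * c) = 1 - c"
    using u v unfolding inverse_of_def by (metis f mult.assoc mult_1_left)+
  moreover have "(1/2) *\<^sub>R ((1 + c) + (1 - c)) = (1::'a)"
    by (simp add: scaleR_2[symmetric])
  ultimately show ?thesis
    unfolding inverse_of_def by (simp only: distrib_left distrib_right mult_scaleR_left mult_scaleR_right simp_thms)
qed

text \<open>The resolvent identity \<open>F z - F w = (z - w) F z a F w\<close> first bounds \<open>F z\<close> by
  \<open>2 \<parallel>F w\<parallel>\<close> for \<open>z\<close> near \<open>w\<close>, and then makes the difference small.\<close>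

lemma resolvent_continuous:
  fixes a :: "'a::unital_cstar_algebra"
  assumes F: "\<And>z. z \<in> S \<Longrightarrow> inverse_of (1 - z *\<^sub>C a) (F z)"
  shows "continuous_on S F"
proof -
  have res: "F z - F w = (z - w) *\<^sub>C (F z * a * F w)" if "z \<in> S" "w \<in> S" for z w
  proof -
    have "F z - F w = F z * ((1 - w *\<^sub>C a) * F w) - (F z * (1 - z *\<^sub>C a)) * F w"
      using F[OF that(1)] F[OF that(2)] by (simp add: inverse_of_def)
    also have "\<dots> = F z * ((z - w) *\<^sub>C a) * F w"
      by (simp add: algebra_simps scaleC_diff_left)
    finally show ?thesis by (simp add: mult_scaleC_left mult_scaleC_right mult.assoc)
  qed
  have "(F \<longlongrightarrow> F w) (at w within S)" if w: "w \<in> S" for w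
  proof -
    define K where "K = norm a * norm (F w)"
    have K0: "0 \<le> K" by (simp add: K_def)
    have b: "norm (F z - F w) \<le> cmod (z - w) * (norm (F z) * K)" if z: "z \<in> S" for z
    proof -
      have "norm (F z * a * F w) \<le> norm (F z) * K"
        unfolding K_def
        by (metis (no_types, opaque_lifting) mult.assoc mult_left_mono norm_ge_zero norm_mult_ineq order_trans)
      then show ?thesis
        unfolding res[OF z w] norm_scaleC by (rule mult_left_mono) simp
    qed
    have tz: "((\<lambda>z. z - w) \<longlongrightarrow> 0) (at w within S)"
      by (rule tendsto_eq_intros | simp)+
    have t0: "((\<lambda>z. cmod (z - w) * K) \<longlongrightarrow> 0) (at w within S)"
      using tendsto_mult_left_zero[OF tendsto_norm_zero[OF tz], of K] by simp
    then have ev: "\<forall>\<^sub>F z in at w within S. cmod (z - w) * K < 1/2"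
      by (rule order_tendstoD) simp
    have evS: "\<forall>\<^sub>F z in at w within S. z \<in> S"
      by (simp add: eventually_at_filter)
    have "\<forall>\<^sub>F z in at w within S. norm (F z - F w) \<le> cmod (z - w) * K * (2 * norm (F w))"
      using ev evS
    proof eventually_elim
      case (elim z)
      have n: "norm (F z - F w) \<le> cmod (z - w) * K * norm (F z)"
        using b[OF elim(2)] by (simp add: mult_ac)
      also have "\<dots> \<le> 1/2 * norm (F z)"
        using elim(1) by (intro mult_right_mono) auto
      finally have "norm (F z) \<le> 2 * norm (F w)"
        using norm_triangle_ineq2[of "F z" "F w"] by simp
      then have "cmod (z - w) * K * norm (F z) \<le> cmod (z - w) * K * (2 * norm (F w))"
        using K0 by (intro mult_left_mono) auto
      with n show ?case by simp
    qed
    moreover have "((\<lambda>z. cmod (z - w) * K * (2 * norm (F w))) \<longlongrightarrow> 0) (at w within S)"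
      by (rule tendsto_mult_left_zero[OF t0])
    ultimately have "((\<lambda>z. F z - F w) \<longlongrightarrow> 0) (at w within S)"
      by (rule Lim_null_comparison)
    then show ?thesis using LIM_zero_iff by blast
  qed
  then show ?thesis by (simp add: continuous_on)
qed

lemma power_double: "b ^ (2 ^ Suc n) = b ^ (2 ^ n) * b ^ (2 ^ n)"
  for b :: "'a::monoid_mult"
  by (simp add: power_add[symmetric] mult_2)

text \<open>Part of the spectral radius formula, by Rickart's elementary averaging argument. The
  resolvent \<open>F z\<close> of \<open>1 - z a\<close> is uniformly continuous on the closed unit
  disc, so that for some \<open>\<rho> < 1\<close> the inverses of \<open>1 - z a\<close> and of
  \<open>1 - \<rho> z a\<close> are close to each other, uniformly on the unit circle. Averaging over
  square roots transfers the same closeness to the powers \<open>b = a\<^sup>N\<close>, where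
  \<open>N\<close> is a power of two, with \<open>\<rho>\<close> replaced by
  \<open>\<rho>\<^sup>N\<close>. As \<open>\<rho>\<^sup>N b\<close> tends to \<open>0\<close>, the
  inverse of \<open>1 - b\<close> is eventually close to \<open>1\<close>, and then \<open>b\<close> is
  small.\<close>

lemma some_power_contracts:
  fixes a :: "'a::unital_cstar_algebra"
  assumes a: "norm a \<le> 1"
    and inv: "\<And>z. cmod z \<le> 1 \<Longrightarrow> \<exists>b. inverse_of (1 - z *\<^sub>C a) b"
  shows "\<exists>n. norm (a ^ (2 ^ n)) < 1"
proof -
  obtain F where F: "\<And>z. cmod z \<le> 1 \<Longrightarrow> inverse_of (1 - z *\<^sub>C a) (F z)"
    using inv by metis
  have "continuous_on (cball 0 1) F"
    by (rule resolvent_continuous[of _ a]) (simp add: F)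
  then have "uniformly_continuous_on (cball 0 1) F"
    by (rule compact_uniformly_continuous) simp
  then obtain \<delta> where \<delta>: "\<delta> > 0"
    "\<And>z z'. \<lbrakk>cmod z \<le> 1; cmod z' \<le> 1; cmod (z' - z) < \<delta>\<rbrakk> \<Longrightarrow> norm (F z' - F z) < 1/8"
    unfolding uniformly_continuous_on_def
    by (metis dist_norm divide_pos_pos zero_less_numeral zero_less_one mem_cball_0)
  define \<rho> where "\<rho> = 1 - min \<delta> 1 / 2"
  have \<rho>: "0 \<le> \<rho>" "\<rho> < 1" "1 - \<rho> < \<delta>"
    using \<delta>(1) by (auto simp: \<rho>_def min_def)
  \<comment> \<open>Averaging over the two square roots of \<open>z\<close> carries the estimate from \<open>a ^ (2 ^ n)\<close> to its square.\<close>
  have close: "\<exists>u v. inverse_of (1 - z *\<^sub>C a ^ (2 ^ n)) u \<and>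
      inverse_of (1 - (\<rho> ^ (2 ^ n) * z) *\<^sub>C a ^ (2 ^ n)) v \<and> norm (u - v) \<le> 1/8"
    if "cmod z = 1" for z :: complex and n
    using that
  proof (induction n arbitrary: z)
    case 0
    have "cmod (\<rho> * z) \<le> 1" using 0 \<rho> by (simp add: norm_mult)
    moreover have "cmod (z - \<rho> * z) < \<delta>"
    proof -
      have "z - \<rho> * z = complex_of_real (1 - \<rho>) * z" by (simp add: algebra_simps)
      then have "cmod (z - \<rho> * z) = \<bar>1 - \<rho>\<bar>" using 0 by (simp only: norm_mult norm_of_real mult_1_right)
      then show ?thesis using \<rho> by simp
    qed
    ultimately have "norm (F z - F (\<rho> * z)) < 1/8"
      by (intro \<delta>(2)) (use 0 in auto)
    then show ?case
      using F[of z] F[of "\<rho> * z"] 0 \<open>cmod (\<rho> * z) \<le> 1\<close> by (auto intro!: exI less_imp_le)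
  next
    case (Suc n)
    define w where "w = csqrt z"
    have w: "w * w = z" "cmod w = 1" "cmod (- w) = 1"
      using Suc.prems power2_csqrt[of z] by (auto simp: w_def power2_eq_square norm_csqrt)
    define b where "b = a ^ (2 ^ n)"
    define r where "r = complex_of_real (\<rho> ^ (2 ^ n))"
    obtain u1 v1 u2 v2 where
      1: "inverse_of (1 - w *\<^sub>C b) u1" "inverse_of (1 - (r * w) *\<^sub>C b) v1" "norm (u1 - v1) \<le> 1/8"
      and 2: "inverse_of (1 + w *\<^sub>C b) u2" "inverse_of (1 + (r * w) *\<^sub>C b) v2" "norm (u2 - v2) \<le> 1/8"
      using Suc.IH[OF w(2)] Suc.IH[OF w(3)] by (auto simp: b_def r_def)
    have "inverse_of (1 - z *\<^sub>C (b * b)) ((1/2) *\<^sub>R (u1 + u2))"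
      using inverse_of_average[OF 1(1) 2(1)] w
      by (simp add: mult_scaleC_left mult_scaleC_right scaleC_scaleC)
    moreover have "inverse_of (1 - (r * r * z) *\<^sub>C (b * b)) ((1/2) *\<^sub>R (v1 + v2))"
    proof -
      have "r * w * (r * w) = r * r * z" using w(1) by (metis mult.assoc mult.left_commute)
      moreover have "inverse_of (1 - (r * w * (r * w)) *\<^sub>C (b * b)) ((1/2) *\<^sub>R (v1 + v2))"
        using inverse_of_average[OF 1(2) 2(2)]
        by (simp add: mult_scaleC_left mult_scaleC_right scaleC_scaleC)
      ultimately show ?thesis by metis
    qed
    moreover have "norm ((1/2) *\<^sub>R (u1 + u2) - (1/2) *\<^sub>R (v1 + v2)) \<le> 1/8"
    proof -
      have "(1/2) *\<^sub>R (u1 + u2) - (1/2) *\<^sub>R (v1 + v2) = (1/2) *\<^sub>R ((u1 - v1) + (u2 - v2))"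
        by (simp add: algebra_simps)
      then show ?thesis
        using norm_triangle_ineq[of "u1 - v1" "u2 - v2"] 1(3) 2(3) by simp
    qed
    moreover have "a ^ (2 ^ Suc n) = b * b" "complex_of_real (\<rho> ^ (2 ^ Suc n)) = r * r"
      by (simp_all only: b_def r_def power_double of_real_mult)
    ultimately show ?case by metis
  qed
  have "(\<lambda>n. \<rho> ^ n) \<longlonglongrightarrow> 0" using \<rho> by (intro LIMSEQ_realpow_zero) auto
  then have "\<forall>\<^sub>F n in sequentially. \<rho> ^ n < 1/9" by (rule order_tendstoD) simp
  then obtain N where N: "\<And>n. n \<ge> N \<Longrightarrow> \<rho> ^ n < 1/9"
    by (auto simp: eventually_sequentially)
  \<comment> \<open>Errors of \<open>1/8\<close> from the closeness estimate and from \<open>v - 1\<close> add up to \<open>1/4\<close>, which forces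
    \<open>\<parallel>b\<parallel> \<le> 1/3\<close>; a factor \<open>1/9\<close> in \<open>c\<close> makes the second error \<open>(1/9) / (1 - 1/9) = 1/8\<close>.\<close>
  define b where "b = a ^ (2 ^ N)"
  define c where "c = \<rho> ^ (2 ^ N) *\<^sub>R b"
  obtain u v where uv: "inverse_of (1 - b) u" "inverse_of (1 - c) v" "norm (u - v) \<le> 1/8"
    using close[of 1 N] by (auto simp: b_def c_def scaleC_one scaleR_scaleC)
  have "norm b \<le> 1"
    unfolding b_def using norm_power_ineq[of a "2 ^ N"] a power_le_one[of "norm a" "2 ^ N"] by simp
  moreover have "\<rho> ^ (2 ^ N) < 1/9"
    by (rule N) (simp add: less_imp_le)
  ultimately have "norm c \<le> 1/9 * 1"
    unfolding c_def norm_scaleR using \<rho> by (intro mult_mono) auto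
  have "norm (v - 1) \<le> 1/8"
  proof -
    have "v - 1 = (v - 1) * c + c" using uv(2) by (simp add: inverse_of_def algebra_simps)
    then have "norm (v - 1) \<le> norm (v - 1) * norm c + norm c"
      by (metis norm_mult_ineq norm_triangle_le add_right_mono)
    also have "\<dots> \<le> norm (v - 1) * (1/9) + 1/9"
      using \<open>norm c \<le> 1/9 * 1\<close> by (intro add_mono mult_left_mono) auto
    finally show ?thesis by simp
  qed
  then have u: "norm (u - 1) \<le> 1/4"
    using norm_triangle_ineq[of "u - v" "v - 1"] uv(3) by simp
  have "b = (u - 1) * (1 - b)" using uv(1) by (simp add: inverse_of_def algebra_simps)
  then have "norm b \<le> norm (u - 1) * norm (1 - b)" by (metis norm_mult_ineq)
  also have "\<dots> \<le> 1/4 * (1 + norm b)"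
    using u norm_triangle_ineq4[of 1 b] by (intro mult_mono) auto
  finally have "norm b < 1" by simp
  then show ?thesis unfolding b_def by blast
qed

lemma norm_selfadjoint_power:
  fixes a :: "'a::unital_cstar_algebra"
  assumes "star a = a"
  shows "norm (a ^ (2 ^ n)) = norm a ^ (2 ^ n)"
proof -
  have sa: "star (a ^ k) = a ^ k" for k
    by (induction k) (simp_all add: star_mult assms power_commutes)
  show ?thesis
  proof (induction n)
    case (Suc n)
    have "norm (a ^ (2 ^ Suc n)) = norm (star (a ^ (2 ^ n)) * a ^ (2 ^ n))"
      by (simp only: power_double sa)
    then show ?case
      by (simp only: cstar_identity Suc power2_eq_square power_double)
  qed simp
qed

text \<open>Otherwise the spectrum, being real and bounded by \<open>\<parallel>a\<parallel>\<close>, lies strictly inside the disc of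
  radius \<open>\<parallel>a\<parallel>\<close>. After
  rescaling to norm one, some power of \<open>a\<close> would then have norm below one, whereas the C*-identity
  makes the norm multiplicative on the repeated squares of a self-adjoint element.\<close>

lemma norm_in_spectrum:
  fixes a :: "'a::unital_cstar_algebra"
  assumes sa: "star a = a"
  shows "complex_of_real (norm a) \<in> spectrum a \<or> complex_of_real (- norm a) \<in> spectrum a"
proof (rule ccontr)
  assume n: "\<not> ?thesis"
  define r where "r = norm a"
  have out: "c \<notin> spectrum a" if "r \<le> cmod c" for c
  proof
    assume c: "c \<in> spectrum a"
    have "Im c = 0" using spectrum_selfadjoint_real[OF sa c] .
    moreover have "cmod c = r" using cmod_spectrum_le_norm[OF c] that by (simp add: r_def)
    ultimately have "\<bar>Re c\<bar> = r" by (simp add: cmod_eq_Re)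
    then have "c = complex_of_real r \<or> c = complex_of_real (- r)"
      using \<open>Im c = 0\<close> by (auto simp: complex_eq_iff)
    with c n show False by (auto simp: r_def)
  qed
  have r: "r > 0"
  proof (rule ccontr)
    assume "\<not> r > 0"
    then have "a = 0" by (simp add: r_def)
    then have "0 \<in> spectrum a" by (simp add: spectrum_def)
    then show False using out[of 0] \<open>a = 0\<close> by (simp add: r_def)
  qed
  define b where "b = (1 / r) *\<^sub>R a"
  have b1: "norm b = 1" using r by (simp add: b_def r_def)
  have "\<exists>d. inverse_of (1 - z *\<^sub>C b) d" if z: "cmod z \<le> 1" for z
  proof (cases "z = 0")
    case True
    then show ?thesis by (auto simp: inverse_of_def)
  next
    case False
    have "r / z \<notin> spectrum a"
      by (rule out) (use z False r in \<open>simp add: norm_divide field_simps\<close>)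
    then obtain d where d: "inverse_of (a - (r / z) *\<^sub>C 1) d"
      using not_in_spectrum_iff by blast
    have "(- (z / r)) *\<^sub>C (a - (r / z) *\<^sub>C 1) = 1 - z *\<^sub>C b"
      using False r by (simp add: scaleC_diff_right scaleC_scaleC scaleC_one b_def scaleR_scaleC)
    then show ?thesis
      using inverse_of_scaleC[OF d, of "- (z / r)"] False r by auto
  qed
  then obtain n where "norm (b ^ (2 ^ n)) < 1"
    using some_power_contracts[of b] b1 by auto
  moreover have "star b = b" by (simp add: b_def sa)
  ultimately show False
    using norm_selfadjoint_power[of b n] b1 by simp
qed


section \<open>The positive cone\<close>

text \<open>Together with the next lemma this describes positivity by the norm alone: a self-adjoint \<open>a\<close> is
  positive iff it lies within distance \<open>t\<close> of the scalar \<open>t\<close>, for \<open>t = \<parallel>a\<parallel>\<close> or equally for some \<open>t\<close>. All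
  spectral values are real and lie in the disc of radius \<open>t\<close> around \<open>t\<close>, hence are nonnegative.\<close>

lemma positive_coneI:
  fixes a :: "'a::unital_cstar_algebra"
  assumes sa: "star a = a" and le: "norm (t *\<^sub>R 1 - a) \<le> t"
  shows "a \<in> positive_cone"
proof -
  have "c \<in> \<real>\<^sub>\<ge>\<^sub>0" if c: "c \<in> spectrum a" for c
  proof -
    have "complex_of_real t - c \<in> spectrum (t *\<^sub>R 1 - a)"
      unfolding scaleR_scaleC using spectrum_reflect c by blast
    then have "cmod (complex_of_real t - c) \<le> t"
      using cmod_spectrum_le_norm le by fastforce
    then have "t - Re c \<le> t"
      using complex_Re_le_cmod[of "complex_of_real t - c"] by simp
    then show ?thesis
      using spectrum_selfadjoint_real[OF sa c] by (simp add: complex_nonneg_Reals_iff)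
  qed
  with sa show ?thesis by (auto simp: positive_cone_def)
qed

text \<open>The norm of \<open>s = \<parallel>a\<parallel> - a\<close> is a spectral value of \<open>s\<close> up to sign, so \<open>\<parallel>a\<parallel> - \<parallel>s\<parallel>\<close> or
  \<open>\<parallel>a\<parallel> + \<parallel>s\<parallel>\<close> is in the spectrum of \<open>a\<close>. The former is then nonnegative; the latter is at most
  \<open>\<parallel>a\<parallel>\<close>, so that \<open>s = 0\<close>.\<close>

lemma positive_cone_norm:
  fixes a :: "'a::unital_cstar_algebra"
  assumes "a \<in> positive_cone"
  shows "norm (norm a *\<^sub>R 1 - a) \<le> norm a"
proof -
  define s where "s = norm a *\<^sub>R 1 - a"
  have sa: "star a = a" and pos: "\<And>c. c \<in> spectrum a \<Longrightarrow> c \<in> \<real>\<^sub>\<ge>\<^sub>0"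
    using assms by (auto simp: positive_cone_def)
  have refl: "complex_of_real (norm a - x) \<in> spectrum a" if "complex_of_real x \<in> spectrum s" for x
    using that spectrum_reflect[of "complex_of_real (norm a)" "complex_of_real (norm a - x)" a]
    by (simp add: s_def scaleR_scaleC)
  have "star s = s" by (simp add: s_def sa star_diff)
  from norm_in_spectrum[OF this]
  consider "complex_of_real (norm a - norm s) \<in> spectrum a"
    | "complex_of_real (norm a - (- norm s)) \<in> spectrum a"
    using refl by blast
  then have "norm s \<le> norm a"
  proof cases
    case 1
    from pos[OF this] show ?thesis by (simp add: complex_nonneg_Reals_iff)
  next
    case 2
    have "cmod (complex_of_real (norm a - (- norm s))) = norm a + norm s"
      by (simp only: norm_of_real) simp
    with cmod_spectrum_le_norm[OF 2] show ?thesis using norm_ge_zero[of a] by linarith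
  qed
  then show ?thesis by (simp add: s_def)
qed

lemma convex_cone_positive_cone: "convex_cone (positive_cone :: 'a::unital_cstar_algebra set)"
  unfolding convex_cone_iff
proof (intro conjI ballI allI impI)
  show "(0::'a) \<in> positive_cone" by (rule positive_coneI[of _ 0]) simp_all
  fix a b :: 'a assume ab: "a \<in> positive_cone" "b \<in> positive_cone"
  show "a + b \<in> positive_cone"
  proof (rule positive_coneI)
    show "star (a + b) = a + b" using ab by (simp add: positive_cone_def star_add)
    have "(norm a + norm b) *\<^sub>R 1 - (a + b) = (norm a *\<^sub>R 1 - a) + (norm b *\<^sub>R 1 - b)"
      by (simp add: algebra_simps)
    then show "norm ((norm a + norm b) *\<^sub>R 1 - (a + b)) \<le> norm a + norm b"
      using positive_cone_norm[OF ab(1)] positive_cone_norm[OF ab(2)]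
      by (simp only: norm_triangle_mono)
  qed
next
  fix a :: 'a and c :: real assume a: "a \<in> positive_cone" and c: "0 \<le> c"
  show "c *\<^sub>R a \<in> positive_cone"
  proof (rule positive_coneI)
    show "star (c *\<^sub>R a) = c *\<^sub>R a" using a by (simp add: positive_cone_def)
    have "(c * norm a) *\<^sub>R 1 - c *\<^sub>R a = c *\<^sub>R (norm a *\<^sub>R 1 - a)"
      by (simp add: algebra_simps)
    then show "norm ((c * norm a) *\<^sub>R 1 - c *\<^sub>R a) \<le> c * norm a"
      using c positive_cone_norm[OF a] by (simp add: mult_left_mono)
  qed
qed

lemma closed_positive_cone: "closed (positive_cone :: 'a::unital_cstar_algebra set)"
  unfolding closed_sequential_limits
proof (intro allI impI, elim conjE)
  fix x :: "nat \<Rightarrow> 'a" and l assume x: "\<forall>n. x n \<in> positive_cone" and l: "x \<longlonglongrightarrow> l"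
  show "l \<in> positive_cone"
  proof (rule positive_coneI)
    have "(\<lambda>n. norm (star (x n) - star l)) \<longlonglongrightarrow> 0"
      using l by (simp flip: star_diff add: LIM_zero_iff tendsto_norm_zero_iff)
    then have "(\<lambda>n. star (x n)) \<longlonglongrightarrow> star l"
      by (simp add: LIM_zero_iff tendsto_norm_zero_iff)
    moreover have "star (x n) = x n" for n using x by (simp add: positive_cone_def)
    ultimately show "star l = l" using l LIMSEQ_unique by auto
    show "norm (norm l *\<^sub>R 1 - l) \<le> norm l"
    proof (rule LIMSEQ_le)
      show "(\<lambda>n. norm (norm (x n) *\<^sub>R 1 - x n)) \<longlonglongrightarrow> norm (norm l *\<^sub>R 1 - l)"
        by (intro tendsto_intros l)
      show "(\<lambda>n. norm (x n)) \<longlonglongrightarrow> norm l" by (intro tendsto_intros l)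
    qed (use x positive_cone_norm in blast)
  qed
qed



section \<open>Bochner integrals in nonseparable Banach spaces\<close>

text \<open>The measure need not be complete and \<^const>\<open>strongly_measurable\<close> allows an exceptional null set.
  Off a measurable null set, \<open>f\<close> agrees with a Borel function that is an everywhere limit of
  simple functions. Through this function the calculus of \<^const>\<open>nn_integral\<close>, much of which assumes
  measurability, becomes available for the norm of \<open>f\<close>.\<close>

lemma strongly_measurable_borel:
  fixes f :: "'w \<Rightarrow> 'b::real_normed_vector"
  assumes "strongly_measurable M f"
  shows "\<exists>s g. (\<forall>i. simple_function M (s i)) \<and> (\<forall>w\<in>space M. (\<lambda>i. s i w) \<longlonglongrightarrow> g w) \<and>
    g \<in> borel_measurable M \<and> (AE w in M. f w = g w)"
proof -
  obtain s where s: "\<And>i. simple_function M (s i)" and ae: "AE w in M. (\<lambda>i. s i w) \<longlonglongrightarrow> f w"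
    using assms by (auto simp: strongly_measurable_def)
  obtain N where N: "N \<in> null_sets M" "{w \<in> space M. \<not> (\<lambda>i. s i w) \<longlonglongrightarrow> f w} \<subseteq> N"
    using ae by (auto simp: eventually_ae_filter)
  define g where "g w = (if w \<in> N then 0 else f w)" for w
  define t where "t i w = (if w \<in> N then 0 else s i w)" for i w
  have t: "simple_function M (t i)" for i
  proof -
    have "simple_function M (indicator N :: 'w \<Rightarrow> real)"
      using N(1) by (intro simple_function_indicator) auto
    from simple_function_compose2[OF this s, of "\<lambda>c x. (1 - c) *\<^sub>R x" i]
    have "simple_function M (\<lambda>w. (1 - indicator N w) *\<^sub>R s i w)" .
    also have "(\<lambda>w. (1 - indicator N w) *\<^sub>R s i w) = t i"
      by (auto simp: t_def indicator_def)
    finally show ?thesis .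
  qed
  have lim: "(\<lambda>i. t i w) \<longlonglongrightarrow> g w" if "w \<in> space M" for w
    using that N(2) by (auto simp: t_def g_def)
  have meas: "g \<in> borel_measurable M"
    by (rule borel_measurable_LIMSEQ_metric[OF borel_measurable_simple_function[OF t] lim])
  have "AE w in M. w \<notin> N" using N(1) by (rule AE_not_in)
  then have "AE w in M. f w = g w" by eventually_elim (simp add: g_def)
  with t lim meas show ?thesis by blast
qed

lemma strongly_measurable_simple_function: "simple_function M s \<Longrightarrow> strongly_measurable M s"
  unfolding strongly_measurable_def by (intro exI[of _ "\<lambda>_. s"]) auto

lemma strongly_measurable_compose2:
  assumes f: "strongly_measurable M f" and g: "strongly_measurable M g"
    and h: "\<And>x y u v. u \<longlonglongrightarrow> x \<Longrightarrow> v \<longlonglongrightarrow> y \<Longrightarrow> (\<lambda>i. h (u i) (v i)) \<longlonglongrightarrow> h x y"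
  shows "strongly_measurable M (\<lambda>w. h (f w) (g w))"
proof -
  obtain s t where st: "\<And>i. simple_function M (s i)" "\<And>i. simple_function M (t i)"
    and ae: "AE w in M. (\<lambda>i. s i w) \<longlonglongrightarrow> f w" "AE w in M. (\<lambda>i. t i w) \<longlonglongrightarrow> g w"
    using f g by (auto simp: strongly_measurable_def)
  have "AE w in M. (\<lambda>i. h (s i w) (t i w)) \<longlonglongrightarrow> h (f w) (g w)"
    using ae by eventually_elim (rule h)
  moreover have "simple_function M (\<lambda>w. h (s i w) (t i w))" for i
    using st by (rule simple_function_compose2)
  ultimately show ?thesis
    unfolding strongly_measurable_def by (intro exI[of _ "\<lambda>i w. h (s i w) (t i w)"]) auto
qed

lemma strongly_measurable_add:
  "strongly_measurable M f \<Longrightarrow> strongly_measurable M g \<Longrightarrow> strongly_measurable M (\<lambda>w. f w + g w)"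
  by (rule strongly_measurable_compose2[where h="(+)"]) (auto intro: tendsto_intros)

lemma strongly_measurable_diff:
  "strongly_measurable M f \<Longrightarrow> strongly_measurable M g \<Longrightarrow> strongly_measurable M (\<lambda>w. f w - g w)"
  by (rule strongly_measurable_compose2[where h="(-)"]) (auto intro: tendsto_intros)

lemma strongly_measurable_scaleR:
  "strongly_measurable M f \<Longrightarrow> strongly_measurable M (\<lambda>w. c *\<^sub>R f w)"
  by (rule strongly_measurable_compose2[where h="\<lambda>x _. c *\<^sub>R x"]) (auto intro: tendsto_intros)

lemma nn_integral_norm_add:
  assumes f: "strongly_measurable M f" and g: "strongly_measurable M g"
  shows "(\<integral>\<^sup>+w. ennreal (norm (f w) + norm (g w)) \<partial>M) =
    (\<integral>\<^sup>+w. ennreal (norm (f w)) \<partial>M) + (\<integral>\<^sup>+w. ennreal (norm (g w)) \<partial>M)"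
proof -
  obtain f' where f': "f' \<in> borel_measurable M" "AE w in M. f w = f' w"
    using strongly_measurable_borel[OF f] by blast
  obtain g' where g': "g' \<in> borel_measurable M" "AE w in M. g w = g' w"
    using strongly_measurable_borel[OF g] by blast
  have [measurable]: "(\<lambda>w. norm (f' w)) \<in> borel_measurable M" "(\<lambda>w. norm (g' w)) \<in> borel_measurable M"
    using f'(1) g'(1) by auto
  have "(\<integral>\<^sup>+w. ennreal (norm (f w) + norm (g w)) \<partial>M) =
    (\<integral>\<^sup>+w. ennreal (norm (f' w)) + ennreal (norm (g' w)) \<partial>M)"
    by (rule nn_integral_cong_AE) (use f'(2) g'(2) in eventually_elim, simp)
  also have "\<dots> = (\<integral>\<^sup>+w. ennreal (norm (f' w)) \<partial>M) + (\<integral>\<^sup>+w. ennreal (norm (g' w)) \<partial>M)"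
    by (rule nn_integral_add) measurable
  also have "(\<integral>\<^sup>+w. ennreal (norm (f' w)) \<partial>M) = (\<integral>\<^sup>+w. ennreal (norm (f w)) \<partial>M)"
    by (rule nn_integral_cong_AE) (use f'(2) in eventually_elim, simp)
  also have "(\<integral>\<^sup>+w. ennreal (norm (g' w)) \<partial>M) = (\<integral>\<^sup>+w. ennreal (norm (g w)) \<partial>M)"
    by (rule nn_integral_cong_AE) (use g'(2) in eventually_elim, simp)
  finally show ?thesis .
qed

lemma nn_integral_norm_triangle:
  assumes f: "strongly_measurable M f" and g: "strongly_measurable M g"
    and le: "\<And>w. w \<in> space M \<Longrightarrow> norm (h w) \<le> norm (f w) + norm (g w)"
  shows "(\<integral>\<^sup>+w. ennreal (norm (h w)) \<partial>M) \<le>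
    (\<integral>\<^sup>+w. ennreal (norm (f w)) \<partial>M) + (\<integral>\<^sup>+w. ennreal (norm (g w)) \<partial>M)"
  unfolding nn_integral_norm_add[OF f g, symmetric]
  by (intro nn_integral_mono ennreal_leI le)

lemma nn_integral_norm_scaleR:
  assumes f: "strongly_measurable M f"
  shows "(\<integral>\<^sup>+w. ennreal (norm (c *\<^sub>R f w)) \<partial>M) = ennreal \<bar>c\<bar> * (\<integral>\<^sup>+w. ennreal (norm (f w)) \<partial>M)"
proof -
  obtain f' where f': "f' \<in> borel_measurable M" "AE w in M. f w = f' w"
    using strongly_measurable_borel[OF f] by blast
  have [measurable]: "(\<lambda>w. norm (f' w)) \<in> borel_measurable M"
    using f'(1) by auto
  have "(\<integral>\<^sup>+w. ennreal (norm (c *\<^sub>R f w)) \<partial>M) = (\<integral>\<^sup>+w. ennreal \<bar>c\<bar> * ennreal (norm (f' w)) \<partial>M)"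
    by (rule nn_integral_cong_AE) (use f'(2) in eventually_elim, simp add: ennreal_mult)
  also have "\<dots> = ennreal \<bar>c\<bar> * (\<integral>\<^sup>+w. ennreal (norm (f' w)) \<partial>M)"
    by (rule nn_integral_cmult) measurable
  also have "(\<integral>\<^sup>+w. ennreal (norm (f' w)) \<partial>M) = (\<integral>\<^sup>+w. ennreal (norm (f w)) \<partial>M)"
    by (rule nn_integral_cong_AE) (use f'(2) in eventually_elim, simp)
  finally show ?thesis .
qed

lemma simple_bochner_integrable_imp_strongly_measurable:
  "Bochner_Integration.simple_bochner_integrable M s \<Longrightarrow> strongly_measurable M s"
  by (auto intro: strongly_measurable_simple_function elim: simple_bochner_integrable.cases)

lemma has_Bochner_integral_add:
  assumes f: "has_Bochner_integral M f I" and g: "has_Bochner_integral M g J"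
  shows "has_Bochner_integral M (\<lambda>w. f w + g w) (I + J)"
proof -
  obtain s where s: "strongly_measurable M f" "\<And>i. Bochner_Integration.simple_bochner_integrable M (s i)"
    "(\<lambda>i. \<integral>\<^sup>+ w. ennreal (norm (f w - s i w)) \<partial>M) \<longlonglongrightarrow> 0"
    "(\<lambda>i. Bochner_Integration.simple_bochner_integral M (s i)) \<longlonglongrightarrow> I"
    using f unfolding has_Bochner_integral_def by blast
  obtain t where t: "strongly_measurable M g" "\<And>i. Bochner_Integration.simple_bochner_integrable M (t i)"
    "(\<lambda>i. \<integral>\<^sup>+ w. ennreal (norm (g w - t i w)) \<partial>M) \<longlonglongrightarrow> 0"
    "(\<lambda>i. Bochner_Integration.simple_bochner_integral M (t i)) \<longlonglongrightarrow> J"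
    using g unfolding has_Bochner_integral_def by blast
  show ?thesis
    unfolding has_Bochner_integral_def
  proof (intro conjI exI[of _ "\<lambda>i w. s i w + t i w"] allI)
    show "strongly_measurable M (\<lambda>w. f w + g w)"
      using s t by (intro strongly_measurable_add)
    show "Bochner_Integration.simple_bochner_integrable M (\<lambda>w. s i w + t i w)" for i
      using simple_bochner_integrable_compose2[of "(+)", OF _ s(2) t(2)] by simp
    have le: "(\<integral>\<^sup>+ w. ennreal (norm (f w + g w - (s i w + t i w))) \<partial>M) \<le>
        (\<integral>\<^sup>+ w. ennreal (norm (f w - s i w)) \<partial>M) + (\<integral>\<^sup>+ w. ennreal (norm (g w - t i w)) \<partial>M)" for i
      using s t
      by (auto intro!: nn_integral_norm_triangle strongly_measurable_diff norm_diff_triangle_ineq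
          intro: simple_bochner_integrable_imp_strongly_measurable)
    show "(\<lambda>i. \<integral>\<^sup>+ w. ennreal (norm (f w + g w - (s i w + t i w))) \<partial>M) \<longlonglongrightarrow> 0"
      by (rule tendsto_sandwich[OF _ _ tendsto_const tendsto_add[OF s(3) t(3), simplified]])
         (use le in auto)
    show "(\<lambda>i. Bochner_Integration.simple_bochner_integral M (\<lambda>w. s i w + t i w)) \<longlonglongrightarrow> I + J"
      using s t by (simp add: simple_bochner_integral_add tendsto_add)
  qed
qed

lemma has_Bochner_integral_scaleR:
  assumes f: "has_Bochner_integral M f I"
  shows "has_Bochner_integral M (\<lambda>w. c *\<^sub>R f w) (c *\<^sub>R I)"
proof -
  obtain s where s: "strongly_measurable M f" "\<And>i. Bochner_Integration.simple_bochner_integrable M (s i)"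
    "(\<lambda>i. \<integral>\<^sup>+ w. ennreal (norm (f w - s i w)) \<partial>M) \<longlonglongrightarrow> 0"
    "(\<lambda>i. Bochner_Integration.simple_bochner_integral M (s i)) \<longlonglongrightarrow> I"
    using f unfolding has_Bochner_integral_def by blast
  show ?thesis
    unfolding has_Bochner_integral_def
  proof (intro conjI exI[of _ "\<lambda>i w. c *\<^sub>R s i w"] allI)
    show "strongly_measurable M (\<lambda>w. c *\<^sub>R f w)"
      using s by (intro strongly_measurable_scaleR)
    show "Bochner_Integration.simple_bochner_integrable M (\<lambda>w. c *\<^sub>R s i w)" for i
      using s(2) simple_bochner_integrable_compose2[of "\<lambda>x _. c *\<^sub>R x" M "s i" "s i"] by simp
    have "(\<integral>\<^sup>+ w. ennreal (norm (c *\<^sub>R f w - c *\<^sub>R s i w)) \<partial>M) =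
        ennreal \<bar>c\<bar> * (\<integral>\<^sup>+ w. ennreal (norm (f w - s i w)) \<partial>M)" for i
      unfolding scaleR_diff_right[symmetric] by (rule nn_integral_norm_scaleR[OF strongly_measurable_diff[OF s(1)
            simple_bochner_integrable_imp_strongly_measurable[OF s(2)]]])
    then show "(\<lambda>i. \<integral>\<^sup>+ w. ennreal (norm (c *\<^sub>R f w - c *\<^sub>R s i w)) \<partial>M) \<longlonglongrightarrow> 0"
      using ennreal_tendsto_cmult[OF _ s(3), of "ennreal \<bar>c\<bar>"] by simp
    show "(\<lambda>i. Bochner_Integration.simple_bochner_integral M (\<lambda>w. c *\<^sub>R s i w)) \<longlonglongrightarrow> c *\<^sub>R I"
      unfolding simple_bochner_integral_linear[OF linear_scaleR s(2)] by (intro tendsto_intros s(4))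
  qed
qed

lemma has_Bochner_integral_diff:
  assumes "has_Bochner_integral M f I" "has_Bochner_integral M g J"
  shows "has_Bochner_integral M (\<lambda>w. f w - g w) (I - J)"
  using has_Bochner_integral_add[OF assms(1) has_Bochner_integral_scaleR[OF assms(2), of "- 1"]] by simp

lemma has_Bochner_integral_norm_finite:
  assumes "has_Bochner_integral M f I"
  shows "(\<integral>\<^sup>+w. ennreal (norm (f w)) \<partial>M) < \<infinity>"
proof -
  obtain s where s: "strongly_measurable M f" "\<And>i. Bochner_Integration.simple_bochner_integrable M (s i)"
    "(\<lambda>i. \<integral>\<^sup>+ w. ennreal (norm (f w - s i w)) \<partial>M) \<longlonglongrightarrow> 0"
    using assms unfolding has_Bochner_integral_def by blast
  have "\<forall>\<^sub>F i in sequentially. (\<integral>\<^sup>+ w. ennreal (norm (f w - s i w)) \<partial>M) < \<infinity>"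
    using s(3) by (rule order_tendstoD) simp
  then obtain i where i: "(\<integral>\<^sup>+ w. ennreal (norm (f w - s i w)) \<partial>M) < \<infinity>"
    by (meson eventually_happens sequentially_bot)
  have "Bochner_Integration.simple_bochner_integrable M (\<lambda>w. norm (s i w))"
    using simple_bochner_integrable_compose2[of "\<lambda>x _. norm x" M "s i" "s i"] s(2) by simp
  then have "(\<integral>\<^sup>+w. ennreal (norm (s i w)) \<partial>M) < \<infinity>"
    using simple_bochner_integral_eq_nn_integral[of M "\<lambda>w. norm (s i w)"]
    by (metis ennreal_less_top infinity_ennreal_def norm_ge_zero)
  moreover have "norm (f w) \<le> norm (f w - s i w) + norm (s i w)" for w
    using norm_triangle_ineq[of "f w - s i w" "s i w"] by simp
  then have "(\<integral>\<^sup>+w. ennreal (norm (f w)) \<partial>M) \<le>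
      (\<integral>\<^sup>+w. ennreal (norm (f w - s i w)) \<partial>M) + (\<integral>\<^sup>+w. ennreal (norm (s i w)) \<partial>M)"
    using s by (auto intro!: nn_integral_norm_triangle strongly_measurable_diff
        intro: simple_bochner_integrable_imp_strongly_measurable)
  ultimately show ?thesis using i
    by (metis ennreal_add_less_top infinity_ennreal_def order_le_less_trans)
qed

text \<open>Bochner's criterion. The simple functions that converge to \<open>f\<close> need not be integrable, so each
  is set to \<open>0\<close> wherever its norm exceeds \<open>2 \<parallel>f\<parallel>\<close>. The factor \<open>2\<close> ensures that at points with
  \<open>f \<noteq> 0\<close> this eventually changes nothing, and dominated convergence applies.\<close>

lemma ex_has_Bochner_integral:
  fixes f :: "'w \<Rightarrow> 'b::banach"
  assumes f: "strongly_measurable M f" and fin: "(\<integral>\<^sup>+w. ennreal (norm (f w)) \<partial>M) < \<infinity>"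
  shows "\<exists>I. has_Bochner_integral M f I"
proof -
  obtain s g where
    s: "\<And>i. simple_function M (s i)" and lim: "\<And>w. w \<in> space M \<Longrightarrow> (\<lambda>i. s i w) \<longlonglongrightarrow> g w"
    and g: "g \<in> borel_measurable M" and ae: "AE w in M. f w = g w"
    using strongly_measurable_borel[OF f] by blast
  have "(\<integral>\<^sup>+w. ennreal (norm (g w)) \<partial>M) = (\<integral>\<^sup>+w. ennreal (norm (f w)) \<partial>M)"
    by (rule nn_integral_cong_AE) (use ae in eventually_elim, simp)
  with fin have fing: "(\<integral>\<^sup>+w. ennreal (norm (g w)) \<partial>M) < \<infinity>" by simp
  have ng[measurable]: "(\<lambda>w. norm (g w)) \<in> borel_measurable M" using g by auto
  define t where "t i w = (if norm (s i w) \<le> 2 * norm (g w) then s i w else 0)" for i w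
  have t: "simple_function M (t i)" for i
  proof -
    have [measurable]: "(\<lambda>w. norm (s i w)) \<in> borel_measurable M"
      using borel_measurable_simple_function[OF s] by auto
    have "{w \<in> space M. norm (s i w) \<le> 2 * norm (g w)} \<in> sets M" (is "?A \<in> _") by measurable
    then have "simple_function M (indicator ?A :: 'w \<Rightarrow> real)" by (rule simple_function_indicator)
    from simple_function_compose2[OF this s, of "\<lambda>c x. c *\<^sub>R x" i]
    have "simple_function M (\<lambda>w. indicator ?A w *\<^sub>R s i w)" .
    then show ?thesis
      by (rule simple_function_cong[THEN iffD1, rotated]) (auto simp: t_def indicator_def)
  qed
  have tb: "norm (t i w) \<le> 2 * norm (g w)" for i w by (simp add: t_def)
  have tlim: "(\<lambda>i. t i w) \<longlonglongrightarrow> g w" if w: "w \<in> space M" for w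
  proof (cases "g w = 0")
    case True
    then have "t i w = 0" for i using tb[of i w] by simp
    with True show ?thesis by simp
  next
    case False
    then have "\<forall>\<^sub>F i in sequentially. norm (s i w) < 2 * norm (g w)"
      by (intro order_tendstoD[OF tendsto_norm[OF lim[OF w]]]) simp
    then have "\<forall>\<^sub>F i in sequentially. s i w = t i w"
      by eventually_elim (simp add: t_def)
    from Lim_transform_eventually[OF lim[OF w] this] show ?thesis .
  qed
  have gt: "(\<lambda>w. g w - t i w) \<in> borel_measurable M" for i
    by (rule borel_measurable_LIMSEQ_metric[of "\<lambda>j w. s j w - t i w"])
       (auto intro!: borel_measurable_simple_function s t tendsto_intros lim)
  have ebound: "norm (g w - t i w) \<le> 3 * norm (g w)" for i w
    using norm_triangle_ineq4[of "g w" "t i w"] tb[of i w] by simp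
  have e0: "(\<lambda>i. \<integral>\<^sup>+w. ennreal (norm (g w - t i w)) \<partial>M) \<longlonglongrightarrow> (\<integral>\<^sup>+w. 0 \<partial>M)"
  proof (rule nn_integral_dominated_convergence[where w="\<lambda>w. 3 * ennreal (norm (g w))"])
    show "(\<lambda>w. ennreal (norm (g w - t i w))) \<in> borel_measurable M" for i
      using gt[of i] by measurable
    show "AE w in M. ennreal (norm (g w - t i w)) \<le> 3 * ennreal (norm (g w))" for i
      using ebound[of _ i] by (auto intro!: AE_I2 simp: ennreal_mult'[symmetric] simp flip: ennreal_numeral)
    show "(\<integral>\<^sup>+w. 3 * ennreal (norm (g w)) \<partial>M) < \<infinity>"
      using fing by (simp add: nn_integral_cmult ennreal_mult_less_top)
    show "AE w in M. (\<lambda>i. ennreal (norm (g w - t i w))) \<longlonglongrightarrow> 0"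
    proof (rule AE_I2)
      fix w assume "w \<in> space M"
      then have "(\<lambda>i. norm (g w - t i w)) \<longlonglongrightarrow> 0"
        using tendsto_norm_zero[OF LIM_zero[OF tlim]] by (simp add: norm_minus_commute)
      then show "(\<lambda>i. ennreal (norm (g w - t i w))) \<longlonglongrightarrow> 0"
        using tendsto_ennrealI by fastforce
    qed
  qed auto
  define e where "e i = (\<integral>\<^sup>+w. ennreal (norm (f w - t i w)) \<partial>M)" for i
  have "e = (\<lambda>i. \<integral>\<^sup>+w. ennreal (norm (g w - t i w)) \<partial>M)"
    unfolding e_def by (intro ext nn_integral_cong_AE) (use ae in eventually_elim, simp)
  with e0 have e: "e \<longlonglongrightarrow> 0" by simp
  have ti: "Bochner_Integration.simple_bochner_integrable M (t i)" for i
  proof (rule simple_bochner_integrableI_bounded[OF t])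
    have "(\<integral>\<^sup>+w. ennreal (norm (t i w)) \<partial>M) \<le> (\<integral>\<^sup>+w. 2 * ennreal (norm (g w)) \<partial>M)"
      by (intro nn_integral_mono) (use tb[of i] in \<open>auto simp: ennreal_mult'[symmetric] simp flip: ennreal_numeral\<close>)
    also have "\<dots> < \<infinity>" using fing by (simp add: nn_integral_cmult ennreal_mult_less_top)
    finally show "(\<integral>\<^sup>+w. ennreal (norm (t i w)) \<partial>M) < \<infinity>" .
  qed
  define J where "J i = Bochner_Integration.simple_bochner_integral M (t i)" for i
  have J: "ennreal (norm (J i - J j)) \<le> e i + e j" for i j
  proof -
    have int: "Bochner_Integration.simple_bochner_integrable M (\<lambda>w. t i w - t j w)"
      using simple_bochner_integrable_compose2[of "(-)", OF _ ti ti] by simp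
    have "J i - J j = Bochner_Integration.simple_bochner_integral M (\<lambda>w. t i w - t j w)"
      by (simp add: J_def simple_bochner_integral_diff ti)
    then have "ennreal (norm (J i - J j)) \<le> ennreal (Bochner_Integration.simple_bochner_integral M (\<lambda>w. norm (t i w - t j w)))"
      using simple_bochner_integral_norm_bound[OF int] by (simp add: ennreal_leI)
    also have "\<dots> = (\<integral>\<^sup>+w. ennreal (norm (t i w - t j w)) \<partial>M)"
      using simple_bochner_integrable_compose2[of "\<lambda>x _. norm x", OF _ int int]
      by (intro simple_bochner_integral_eq_nn_integral) auto
    also have "\<dots> \<le> e i + e j"
      unfolding e_def
      by (intro nn_integral_norm_triangle strongly_measurable_diff f strongly_measurable_simple_function t)
         (metis norm_diff_triangle_le norm_minus_commute order_refl)
    finally show ?thesis .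
  qed
  have "Cauchy J"
  proof (rule metric_CauchyI)
    fix r :: real assume r: "0 < r"
    have "\<forall>\<^sub>F i in sequentially. e i < ennreal (r / 2)"
      using e by (rule order_tendstoD) (use r in simp)
    then obtain N where N: "\<And>i. i \<ge> N \<Longrightarrow> e i < ennreal (r / 2)"
      by (auto simp: eventually_sequentially)
    have "dist (J i) (J j) < r" if "i \<ge> N" "j \<ge> N" for i j
    proof -
      have "ennreal (norm (J i - J j)) < ennreal (r / 2) + ennreal (r / 2)"
        by (rule order_le_less_trans[OF J add_strict_mono[OF N[OF that(1)] N[OF that(2)]]])
      also have "\<dots> = ennreal r" using r by (simp flip: ennreal_plus)
      finally show ?thesis by (simp add: dist_norm ennreal_less_iff)
    qed
    then show "\<exists>N. \<forall>i\<ge>N. \<forall>j\<ge>N. dist (J i) (J j) < r" by blast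
  qed
  then obtain I where "J \<longlonglongrightarrow> I" using Cauchy_convergent convergent_def by blast
  then have "has_Bochner_integral M f I"
    unfolding has_Bochner_integral_def using f ti e
    by (auto simp: J_def[abs_def] e_def[abs_def] intro!: exI[of _ t])
  then show ?thesis ..
qed

text \<open>The distance to a convex cone is subadditive and positively homogeneous. This is what lets
  it pass under the integral sign below.\<close>

lemma infdist_convex_cone_add:
  fixes C :: "'b::real_normed_vector set"
  assumes C: "convex_cone C"
  shows "infdist (x + y) C \<le> infdist x C + infdist y C"
proof (rule field_le_epsilon)
  fix \<epsilon> :: real assume \<epsilon>: "\<epsilon> > 0"
  have near: "\<exists>c\<in>C. dist z c < infdist z C + \<epsilon> / 2" for z
    using \<epsilon> cInf_lessD[of "dist z ` C" "infdist z C + \<epsilon> / 2"] convex_cone_nonempty[OF C]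
    by (auto simp: infdist_notempty)
  obtain a b where ab: "a \<in> C" "b \<in> C" "dist x a < infdist x C + \<epsilon> / 2" "dist y b < infdist y C + \<epsilon> / 2"
    using near by metis
  have "infdist (x + y) C \<le> dist (x + y) (a + b)"
    using ab convex_cone_add[OF C] by (intro infdist_le) auto
  also have "\<dots> \<le> dist x a + dist y b" by (rule dist_triangle_add)
  finally show "infdist (x + y) C \<le> infdist x C + infdist y C + \<epsilon>" using ab by simp
qed

lemma infdist_convex_cone_scaleR:
  fixes C :: "'b::real_normed_vector set"
  assumes C: "convex_cone C" and r: "0 \<le> r"
  shows "infdist (r *\<^sub>R x) C \<le> r * infdist x C"
proof (cases "r = 0")
  case True
  moreover have "0 \<in> C" using C by (simp add: convex_cone_iff)
  ultimately show ?thesis by simp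
next
  case False
  with r have r: "r > 0" by simp
  have "infdist (r *\<^sub>R x) C / r \<le> infdist x C"
    unfolding infdist_notempty[OF convex_cone_nonempty[OF C]]
  proof (rule cINF_greatest[OF convex_cone_nonempty[OF C]])
    fix c assume c: "c \<in> C"
    have "infdist (r *\<^sub>R x) C \<le> dist (r *\<^sub>R x) (r *\<^sub>R c)"
      using c convex_cone_scaleR[OF C] r by (intro infdist_le) auto
    also have "\<dots> = r * dist x c"
      using r by (simp add: dist_norm flip: scaleR_diff_right)
    finally show "(INF a\<in>C. dist (r *\<^sub>R x) a) / r \<le> dist x c"
      using r by (simp add: infdist_notempty[OF convex_cone_nonempty[OF C]] field_simps)
  qed
  then show ?thesis using r by (simp add: field_simps)
qed

lemma infdist_convex_cone_sum:
  fixes C :: "'b::real_normed_vector set"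
  assumes C: "convex_cone C" and "finite S" and "\<And>i. i \<in> S \<Longrightarrow> 0 \<le> r i"
  shows "infdist (\<Sum>i\<in>S. r i *\<^sub>R x i) C \<le> (\<Sum>i\<in>S. r i * infdist (x i) C)"
  using assms(2,3)
proof (induction S)
  case empty
  have "0 \<in> C" using C by (simp add: convex_cone_iff)
  then show ?case by simp
next
  case (insert i S)
  then show ?case
    using infdist_convex_cone_add[OF C, of "r i *\<^sub>R x i" "\<Sum>i\<in>S. r i *\<^sub>R x i"]
      infdist_convex_cone_scaleR[OF C, of "r i" "x i"] by fastforce
qed

text \<open>The approximating simple functions need not take values in \<open>C\<close>. But the distance of their
  integral from \<open>C\<close> is at most the integral of their distance from \<open>C\<close>, hence at most the
  \<open>L\<^sup>1\<close>-distance to \<open>f\<close>, which tends to \<open>0\<close>.\<close>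

lemma has_Bochner_integral_in_convex_cone:
  fixes f :: "'w \<Rightarrow> 'b::banach"
  assumes int: "has_Bochner_integral M f I" and C: "convex_cone C" "closed C"
    and f: "\<And>w. w \<in> space M \<Longrightarrow> f w \<in> C"
  shows "I \<in> C"
proof -
  obtain s where s: "\<And>i. Bochner_Integration.simple_bochner_integrable M (s i)"
    "(\<lambda>i. \<integral>\<^sup>+ w. ennreal (norm (f w - s i w)) \<partial>M) \<longlonglongrightarrow> 0"
    "(\<lambda>i. Bochner_Integration.simple_bochner_integral M (s i)) \<longlonglongrightarrow> I"
    using int unfolding has_Bochner_integral_def by blast
  have C0: "0 \<in> C" using C by (simp add: convex_cone_iff)
  have le: "ennreal (infdist (Bochner_Integration.simple_bochner_integral M (s i)) C) \<le>
      (\<integral>\<^sup>+ w. ennreal (norm (f w - s i w)) \<partial>M)" for i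
  proof -
    have sf: "simple_function M (s i)" using s(1)[of i] by cases
    have d: "Bochner_Integration.simple_bochner_integrable M (\<lambda>w. infdist (s i w) C)"
      using simple_bochner_integrable_compose2[of "\<lambda>x _. infdist x C", OF _ s(1)[of i] s(1)[of i]] C0 by simp
    have "infdist (Bochner_Integration.simple_bochner_integral M (s i)) C \<le>
        (\<Sum>y\<in>s i ` space M. measure M {w\<in>space M. s i w = y} * infdist y C)"
      unfolding simple_bochner_integral_def
      using sf by (intro infdist_convex_cone_sum C) (auto simp: simple_function_def)
    also have "\<dots> = Bochner_Integration.simple_bochner_integral M (\<lambda>w. infdist (s i w) C)"
      using simple_bochner_integral_partition[OF d sf, of "\<lambda>y. infdist y C"] by simp
    finally have "ennreal (infdist (Bochner_Integration.simple_bochner_integral M (s i)) C) \<le>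
        (\<integral>\<^sup>+ w. ennreal (infdist (s i w) C) \<partial>M)"
      using simple_bochner_integral_eq_nn_integral[OF d] by (metis ennreal_leI infdist_nonneg)
    also have "\<dots> \<le> (\<integral>\<^sup>+ w. ennreal (norm (f w - s i w)) \<partial>M)"
    proof (intro nn_integral_mono ennreal_leI)
      fix w assume "w \<in> space M"
      then show "infdist (s i w) C \<le> norm (f w - s i w)"
        using infdist_le[OF f, of w "s i w"] by (simp add: dist_norm norm_minus_commute)
    qed
    finally show ?thesis .
  qed
  have "(\<lambda>i. ennreal (infdist (Bochner_Integration.simple_bochner_integral M (s i)) C)) \<longlonglongrightarrow> 0"
    by (rule tendsto_sandwich[OF _ _ tendsto_const s(2)]) (use le in auto)
  moreover have "(\<lambda>i. ennreal (infdist (Bochner_Integration.simple_bochner_integral M (s i)) C)) \<longlonglongrightarrow> ennreal (infdist I C)"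
    by (intro tendsto_ennrealI tendsto_infdist s(3))
  ultimately have "ennreal (infdist I C) = 0" by (rule LIMSEQ_unique[rotated])
  then have "infdist I C = 0" using infdist_nonneg[of I C] by (simp add: ennreal_eq_0_iff antisym)
  then show ?thesis
    using in_closed_iff_infdist_zero[OF C(2)] C0 by blast
qed



section \<open>Continuity of the inner product\<close>

context hilbert_module
begin

lemma ip_add_right: "ip x (y + z) = ip x y + ip x z"
  by (metis ip_add_left ip_star star_add)

lemma ip_scaleC_left: "ip (c *\<^sub>C x) y = c *\<^sub>C ip x y"
  using ip_act_left[of "c *\<^sub>C 1" x y] by (simp add: act_scaleC_left act_one mult_scaleC_left)

lemma ip_scaleC_right: "ip x (c *\<^sub>C y) = cnj c *\<^sub>C ip x y"
  by (metis ip_scaleC_left ip_star star_scaleC)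

lemma ip_scaleR_left: "ip (r *\<^sub>R x) y = r *\<^sub>R ip x y"
  by (simp add: scaleR_scaleC ip_scaleC_left)

lemma ip_scaleR_right: "ip x (r *\<^sub>R y) = r *\<^sub>R ip x y"
  by (simp add: scaleR_scaleC ip_scaleC_right)

lemma ip_minus_left: "ip (- x) y = - ip x y"
  using ip_scaleR_left[of "- 1" x y] by simp

lemma ip_minus_right: "ip x (- y) = - ip x y"
  using ip_scaleR_right[of x "- 1" y] by simp

lemma ip_diff_left: "ip (x - y) z = ip x z - ip y z"
  using ip_add_left[of x "- y" z] by (simp add: ip_minus_left)

lemma ip_diff_right: "ip x (y - z) = ip x y - ip x z"
  using ip_add_right[of x y "- z"] by (simp add: ip_minus_right)

lemma norm_ip_self: "norm (ip x x) = (norm x)\<^sup>2"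
  by (simp add: norm_ip)

text \<open>Polarization expresses \<open>ip x y\<close> by elements \<open>ip z z\<close>, whose norm is \<open>\<parallel>z\<parallel>\<^sup>2\<close>. For unit
  vectors this gives the bound \<open>4\<close>; the general case follows by scaling.\<close>

lemma norm_ip_le: "norm (ip x y) \<le> 4 * (norm x * norm y)"
proof -
  have sym: "norm (ip u v + ip v u) \<le> (norm u + norm v)\<^sup>2" for u v
  proof -
    have "2 *\<^sub>R (ip u v + ip v u) = ip (u + v) (u + v) - ip (u - v) (u - v)"
      by (simp add: ip_add_left ip_add_right ip_diff_left ip_diff_right scaleR_2)
    then have "2 * norm (ip u v + ip v u) \<le> (norm (u + v))\<^sup>2 + (norm (u - v))\<^sup>2"
      by (metis norm_ip_self norm_scaleR norm_triangle_ineq4 abs_numeral)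
    also have "\<dots> \<le> (norm u + norm v)\<^sup>2 + (norm u + norm v)\<^sup>2"
      by (intro add_mono power_mono norm_triangle_ineq norm_triangle_ineq4) auto
    finally show ?thesis by simp
  qed
  have gen: "norm (ip u v) \<le> (norm u + norm v)\<^sup>2" for u v
  proof -
    have "\<i> *\<^sub>C (ip u (\<i> *\<^sub>C v) + ip (\<i> *\<^sub>C v) u) = ip u v - ip v u"
      by (simp add: ip_scaleC_left ip_scaleC_right scaleC_add_right scaleC_diff_right scaleC_scaleC scaleC_one)
    then have "norm (ip u v - ip v u) \<le> (norm u + norm v)\<^sup>2"
      using sym[of u "\<i> *\<^sub>C v"] norm_scaleC[of \<i> "ip u (\<i> *\<^sub>C v) + ip (\<i> *\<^sub>C v) u"]
      by (simp add: norm_scaleC)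
    moreover have "2 *\<^sub>R ip u v = (ip u v + ip v u) + (ip u v - ip v u)"
      by (simp add: scaleR_2)
    then have "2 * norm (ip u v) \<le> norm (ip u v + ip v u) + norm (ip u v - ip v u)"
      by (metis norm_scaleR norm_triangle_ineq abs_numeral)
    ultimately show ?thesis using sym[of u v] by simp
  qed
  show ?thesis
  proof (cases "x = 0 \<or> y = 0")
    case True
    then show ?thesis using ip_scaleR_left[of 0 x y] ip_scaleR_right[of x 0 y] by auto
  next
    case False
    have "x = norm x *\<^sub>R sgn x" "y = norm y *\<^sub>R sgn y"
      using False by (simp_all add: sgn_div_norm)
    then have "ip x y = (norm x * norm y) *\<^sub>R ip (sgn x) (sgn y)"
      by (metis ip_scaleR_left ip_scaleR_right scaleR_scaleR)
    moreover have "norm (ip (sgn x) (sgn y)) \<le> 4"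
      using gen[of "sgn x" "sgn y"] False by (simp add: norm_sgn)
    ultimately show ?thesis
      using mult_left_mono[of "norm (ip (sgn x) (sgn y))" 4 "norm x * norm y"] by (simp add: mult_ac)
  qed
qed

lemma bounded_bilinear_ip: "bounded_bilinear ip"
proof
  show "\<exists>K. \<forall>a b. norm (ip a b) \<le> norm a * norm b * K"
    using norm_ip_le by (intro exI[of _ 4]) (simp add: mult.commute)
qed (simp_all add: ip_add_left ip_add_right ip_scaleR_left ip_scaleR_right)

lemma adjointable_add:
  assumes "S \<in> adjointable ip" "T \<in> adjointable ip"
  shows "(\<lambda>x. S x + T x) \<in> adjointable ip"
proof -
  obtain S' T' where "\<forall>x y. ip (S x) y = ip x (S' y)" "\<forall>x y. ip (T x) y = ip x (T' y)"
    using assms by (auto simp: adjointable_def)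
  then show ?thesis
    unfolding adjointable_def
    by (auto intro!: exI[of _ "\<lambda>y. S' y + T' y"] simp: ip_add_left ip_add_right)
qed

lemma adjointable_minus:
  assumes "T \<in> adjointable ip"
  shows "(\<lambda>x. - T x) \<in> adjointable ip"
proof -
  obtain T' where "\<forall>x y. ip (T x) y = ip x (T' y)"
    using assms by (auto simp: adjointable_def)
  then show ?thesis
    unfolding adjointable_def
    by (auto intro!: exI[of _ "\<lambda>y. - T' y"] simp: ip_minus_left ip_minus_right)
qed


section \<open>Perturbation of frames by Bessel families\<close>

lemma ex_has_Bochner_integral_ip_add:
  assumes f: "strongly_measurable \<mu> f" "has_Bochner_integral \<mu> (\<lambda>w. ip (f w) (f w)) I"
    and g: "strongly_measurable \<mu> g" "has_Bochner_integral \<mu> (\<lambda>w. ip (g w) (g w)) J"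
  shows "\<exists>H. has_Bochner_integral \<mu> (\<lambda>w. ip (f w + g w) (f w + g w)) H"
proof (rule ex_has_Bochner_integral)
  note fg = strongly_measurable_add[OF f(1) g(1)]
  show "strongly_measurable \<mu> (\<lambda>w. ip (f w + g w) (f w + g w))"
    by (rule strongly_measurable_compose2[OF fg fg])
       (rule bounded_bilinear.tendsto[OF bounded_bilinear_ip])
  note f2 = has_Bochner_integral_scaleR[OF f(2), of 2]
  note g2 = has_Bochner_integral_scaleR[OF g(2), of 2]
  have "(\<integral>\<^sup>+w. ennreal (norm (ip (f w + g w) (f w + g w))) \<partial>\<mu>) \<le>
      (\<integral>\<^sup>+w. ennreal (norm (2 *\<^sub>R ip (f w) (f w))) \<partial>\<mu>) + (\<integral>\<^sup>+w. ennreal (norm (2 *\<^sub>R ip (g w) (g w))) \<partial>\<mu>)"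
  proof (rule nn_integral_norm_triangle)
    show "strongly_measurable \<mu> (\<lambda>w. 2 *\<^sub>R ip (f w) (f w))" "strongly_measurable \<mu> (\<lambda>w. 2 *\<^sub>R ip (g w) (g w))"
      using f2 g2 by (simp_all add: has_Bochner_integral_def)
    fix w
    have "(norm (f w + g w))\<^sup>2 \<le> (norm (f w) + norm (g w))\<^sup>2"
      by (intro power_mono norm_triangle_ineq) simp
    also have "\<dots> \<le> 2 * (norm (f w))\<^sup>2 + 2 * (norm (g w))\<^sup>2"
      using zero_le_power2[of "norm (f w) - norm (g w)"] by (simp add: power2_sum power2_diff)
    finally show "norm (ip (f w + g w) (f w + g w)) \<le> norm (2 *\<^sub>R ip (f w) (f w)) + norm (2 *\<^sub>R ip (g w) (g w))"
      by (simp add: norm_ip_self)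
  qed
  also have "\<dots> < \<infinity>"
    using has_Bochner_integral_norm_finite[OF f2] has_Bochner_integral_norm_finite[OF g2] by simp
  finally show "(\<integral>\<^sup>+w. ennreal (norm (ip (f w + g w) (f w + g w))) \<partial>\<mu>) < \<infinity>" .
qed

lemma weighted_ip_identity:
  assumes "a * b = 1"
  shows "ip (x + y) (x + y) - (1 - a\<^sup>2) *\<^sub>R ip x x - (1 - b\<^sup>2) *\<^sub>R ip y y =
    ip (a *\<^sub>R x + b *\<^sub>R y) (a *\<^sub>R x + b *\<^sub>R y)"
  using assms
  by (simp add: ip_add_left ip_add_right ip_scaleR_left ip_scaleR_right algebra_simps power2_eq_square)

text \<open>A form of the arithmetic-geometric mean inequality for \<open>ip (f w) (g w) + ip (g w) (f w)\<close>. It stays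
  in the order of the algebra: taking norms would only give a lower bound on \<open>\<parallel>H\<parallel>\<close>, which is weaker
  than a lower bound on \<open>H\<close>.\<close>

lemma ip_integral_add_weighted:
  assumes f: "has_Bochner_integral \<mu> (\<lambda>w. ip (f w) (f w)) I"
    and g: "has_Bochner_integral \<mu> (\<lambda>w. ip (g w) (g w)) J"
    and h: "has_Bochner_integral \<mu> (\<lambda>w. ip (f w + g w) (f w + g w)) H"
    and "a * b = 1"
  shows "H - (1 - a\<^sup>2) *\<^sub>R I - (1 - b\<^sup>2) *\<^sub>R J \<in> positive_cone"
proof -
  have "has_Bochner_integral \<mu>
      (\<lambda>w. ip (f w + g w) (f w + g w) - (1 - a\<^sup>2) *\<^sub>R ip (f w) (f w) - (1 - b\<^sup>2) *\<^sub>R ip (g w) (g w))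
      (H - (1 - a\<^sup>2) *\<^sub>R I - (1 - b\<^sup>2) *\<^sub>R J)"
    by (intro has_Bochner_integral_diff has_Bochner_integral_scaleR f g h)
  then show ?thesis
    by (rule has_Bochner_integral_in_convex_cone[OF _ convex_cone_positive_cone closed_positive_cone])
       (simp only: weighted_ip_identity[OF \<open>a * b = 1\<close>] ip_pos)
qed

text \<open>The parallelogram law, with the positive term \<open>ip (f w - g w) (f w - g w)\<close> dropped.\<close>

lemma ip_integral_add_upper:
  assumes f: "has_Bochner_integral \<mu> (\<lambda>w. ip (f w) (f w)) I"
    and g: "has_Bochner_integral \<mu> (\<lambda>w. ip (g w) (g w)) J"
    and h: "has_Bochner_integral \<mu> (\<lambda>w. ip (f w + g w) (f w + g w)) H"
  shows "2 *\<^sub>R I + 2 *\<^sub>R J - H \<in> positive_cone"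
proof -
  have eq: "2 *\<^sub>R ip x x + 2 *\<^sub>R ip y y - ip (x + y) (x + y) = ip (x - y) (x - y)" for x y
    by (simp add: ip_add_left ip_add_right ip_diff_left ip_diff_right scaleR_2)
  have "has_Bochner_integral \<mu>
      (\<lambda>w. 2 *\<^sub>R ip (f w) (f w) + 2 *\<^sub>R ip (g w) (g w) - ip (f w + g w) (f w + g w))
      (2 *\<^sub>R I + 2 *\<^sub>R J - H)"
    by (intro has_Bochner_integral_diff has_Bochner_integral_add has_Bochner_integral_scaleR f g h)
  then show ?thesis
    by (rule has_Bochner_integral_in_convex_cone[OF _ convex_cone_positive_cone closed_positive_cone])
       (simp only: eq ip_pos)
qed

text \<open>With weights \<open>a\<^sup>2 = t\<close> and \<open>b\<^sup>2 = 1 / t\<close> the lower bound is \<open>(1 - t) A - (1 / t - 1) M\<close>, which is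
  largest for \<open>t = sqrt (M / A)\<close>. Its value there is \<open>A (1 - t)\<^sup>2 = (sqrt A - sqrt M)\<^sup>2\<close>. The condition
  \<open>M < A\<close> gives \<open>t < 1\<close>, so that the bound is positive and the coefficients of both given
  inequalities are nonnegative.\<close>

lemma frame_add_bessel:
  assumes T: "continuous_operator_frame_with_bounds \<mu> ip T A B"
    and R: "continuous_bessel_family \<mu> ip R M" and "M < A"
  shows "continuous_operator_frame_with_bounds \<mu> ip (\<lambda>w x. T w x + R w x)
    (A * (1 - sqrt (M / A))\<^sup>2) (2 * (B + M))"
proof -
  have pos: "0 < A" "0 < B" "0 < M"
    using T R by (auto simp: continuous_operator_frame_with_bounds_def continuous_bessel_family_def)
  define t where "t = sqrt (M / A)"
  have t: "0 < t" "t < 1" using pos \<open>M < A\<close> by (simp_all add: t_def)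
  have M: "M = t\<^sup>2 * A" using pos by (simp add: t_def)
  have bounds: "\<exists>H. has_Bochner_integral \<mu> (\<lambda>w. ip (T w x + R w x) (T w x + R w x)) H \<and>
      (A * (1 - t)\<^sup>2) *\<^sub>R ip x x \<preceq> H \<and> H \<preceq> (2 * (B + M)) *\<^sub>R ip x x" for x
  proof -
    obtain I where I: "has_Bochner_integral \<mu> (\<lambda>w. ip (T w x) (T w x)) I"
      "I - A *\<^sub>R ip x x \<in> positive_cone" "B *\<^sub>R ip x x - I \<in> positive_cone"
      and mT: "strongly_measurable \<mu> (\<lambda>w. T w x)"
      using T unfolding continuous_operator_frame_with_bounds_def cstar_le_def by blast
    obtain J where J: "has_Bochner_integral \<mu> (\<lambda>w. ip (R w x) (R w x)) J"
      "M *\<^sub>R ip x x - J \<in> positive_cone"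
      and mR: "strongly_measurable \<mu> (\<lambda>w. R w x)"
      using R unfolding continuous_bessel_family_def cstar_le_def by blast
    obtain H where H: "has_Bochner_integral \<mu> (\<lambda>w. ip (T w x + R w x) (T w x + R w x)) H"
      using ex_has_Bochner_integral_ip_add[OF mT I(1) mR J(1)] by blast
    note cone = convex_cone_add[OF convex_cone_positive_cone] convex_cone_scaleR[OF convex_cone_positive_cone]
    have "(H - (1 - (sqrt t)\<^sup>2) *\<^sub>R I - (1 - (1 / sqrt t)\<^sup>2) *\<^sub>R J) +
        (1 - t) *\<^sub>R (I - A *\<^sub>R ip x x) + (1 / t - 1) *\<^sub>R (M *\<^sub>R ip x x - J) \<in> positive_cone"
      using t by (intro cone ip_integral_add_weighted[OF I(1) J(1) H] I J) simp_all
    also have "(H - (1 - (sqrt t)\<^sup>2) *\<^sub>R I - (1 - (1 / sqrt t)\<^sup>2) *\<^sub>R J) +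
        (1 - t) *\<^sub>R (I - A *\<^sub>R ip x x) + (1 / t - 1) *\<^sub>R (M *\<^sub>R ip x x - J) =
        H - ((1 - t) * A - (1 / t - 1) * M) *\<^sub>R ip x x"
      using t by (simp add: power_divide scaleR_diff_right scaleR_diff_left left_diff_distrib)
    also have "(1 - t) * A - (1 / t - 1) * M = A * (1 - t)\<^sup>2"
      using t by (simp add: M field_simps power2_eq_square)
    finally have lower: "H - (A * (1 - t)\<^sup>2) *\<^sub>R ip x x \<in> positive_cone" .
    have "(2 *\<^sub>R I + 2 *\<^sub>R J - H) + 2 *\<^sub>R (B *\<^sub>R ip x x - I) + 2 *\<^sub>R (M *\<^sub>R ip x x - J) \<in> positive_cone"
      by (intro cone ip_integral_add_upper[OF I(1) J(1) H] I J) simp_all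
    also have "(2 *\<^sub>R I + 2 *\<^sub>R J - H) + 2 *\<^sub>R (B *\<^sub>R ip x x - I) + 2 *\<^sub>R (M *\<^sub>R ip x x - J) =
        (2 * (B + M)) *\<^sub>R ip x x - H"
      by (simp add: algebra_simps)
    finally show ?thesis using H lower by (auto simp: cstar_le_def)
  qed
  have "0 < A * (1 - t)\<^sup>2" "0 < 2 * (B + M)" using pos t by simp_all
  moreover have "\<forall>w\<in>space \<mu>. (\<lambda>x. T w x + R w x) \<in> adjointable ip"
    using T R by (auto simp: continuous_operator_frame_with_bounds_def continuous_bessel_family_def
        intro: adjointable_add)
  moreover have "\<forall>x. strongly_measurable \<mu> (\<lambda>w. T w x + R w x)"
    using T R by (auto simp: continuous_operator_frame_with_bounds_def continuous_bessel_family_def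
        intro: strongly_measurable_add)
  ultimately show ?thesis
    using bounds unfolding continuous_operator_frame_with_bounds_def t_def by blast
qed

lemma bessel_minus:
  assumes "continuous_bessel_family \<mu> ip R M"
  shows "continuous_bessel_family \<mu> ip (\<lambda>w x. - R w x) M"
  using assms adjointable_minus strongly_measurable_scaleR[of \<mu> "\<lambda>w. R w _" "- 1"]
  by (simp add: continuous_bessel_family_def ip_minus_left ip_minus_right)

end

theorem theorem3p1:
  fixes \<mu> :: "'w measure"
    and act :: "'a::unital_cstar_algebra \<Rightarrow> 'h::cbanach \<Rightarrow> 'h"
    and ip :: "'h \<Rightarrow> 'h \<Rightarrow> 'a"
    and T R :: "'w \<Rightarrow> 'h \<Rightarrow> 'h"
    and A B M :: real
  assumes "hilbert_module act ip"
    and "continuous_operator_frame_with_bounds \<mu> ip T A B"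
    and "continuous_bessel_family \<mu> ip R M"
    and "M < A"
  shows "continuous_operator_frame \<mu> ip (\<lambda>w x. T w x + R w x) \<and>
         continuous_operator_frame \<mu> ip (\<lambda>w x. T w x - R w x)"
proof -
  interpret hilbert_module act ip by fact
  note bessel_minus[OF assms(3)]
  from frame_add_bessel[OF assms(2-4)] frame_add_bessel[OF assms(2) this assms(4)]
  show ?thesis unfolding continuous_operator_frame_def by auto
qed

end
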